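(* The class of $\kappa$-metrizable spaces is a proper subclass of the class of quasi $\kappa$-metrizable spaces: every $\kappa$-metrizable space is quasi $\kappa$-metrizable, and there exists a quasi $\kappa$-metrizable space which is not $\kappa$-metrizable.
   Context: All topological spaces are assumed Tychonoff. A set $C\subset X$ is regularly closed if it is the closure of an open set. For a non-negative real-valued function $\rho(x,C)$ of a point $x\in X$ and a regularly closed set $C\subset X$ consider the conditions: K1) $\rho(x,C)=0$ iff $x\in C$; K1)$^*$ for any regularly closed $C$ there is a dense open subset $V$ of $X\setminus C$ such that $\rho(x,C)>0$ iff $x\in V$; K2) if $C\subset C'$, then $\rho(x,C')\le\rho(x,C)$ for every $x\in X$; K3) for every $C$, $\rho(x,C)$ is a continuous function of $x$; K4) $\rho(x,\overline{\bigcup_\alpha C_\alpha})=\inf_\alpha\rho(x,C_\alpha)$ for every $x\in X$ and every increasing transfinite (i.e. well-ordered by index) family $\{C_\alpha\}$ of regularly closed sets in $X$. $\rho$ is a $\kappa$-metric on $X$ if it satisfies K1)–K4), and a quasi $\kappa$-metric on $X$ if it satisfies K1)$^*$ and K2)–K4). A space is $\kappa$-metrizable (resp. quasi $\kappa$-metrizable) if it admits a $\kappa$-metric (resp. a quasi $\kappa$-metric). *)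

theory Defs
  imports "HOL-Analysis.Analysis"
begin

definition tychonoff_space :: "'a topology \<Rightarrow> bool" where
  "tychonoff_space X \<longleftrightarrow> completely_regular_space X \<and> Hausdorff_space X"

definition regularly_closed_in :: "'a topology \<Rightarrow> 'a set \<Rightarrow> bool" where
  "regularly_closed_in X C \<longleftrightarrow> (\<exists>U. openin X U \<and> C = X closure_of U)"

definition kappa_nonneg :: "'a topology \<Rightarrow> ('a \<Rightarrow> 'a set \<Rightarrow> real) \<Rightarrow> bool" where
  "kappa_nonneg X \<rho> \<longleftrightarrow>
     (\<forall>C. regularly_closed_in X C \<longrightarrow> (\<forall>x\<in>topspace X. 0 \<le> \<rho> x C))"

definition kappa_K1 :: "'a topology \<Rightarrow> ('a \<Rightarrow> 'a set \<Rightarrow> real) \<Rightarrow> bool" where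
  "kappa_K1 X \<rho> \<longleftrightarrow>
     (\<forall>C. regularly_closed_in X C \<longrightarrow> (\<forall>x\<in>topspace X. \<rho> x C = 0 \<longleftrightarrow> x \<in> C))"

definition kappa_K1_star :: "'a topology \<Rightarrow> ('a \<Rightarrow> 'a set \<Rightarrow> real) \<Rightarrow> bool" where
  "kappa_K1_star X \<rho> \<longleftrightarrow>
     (\<forall>C. regularly_closed_in X C \<longrightarrow>
       (\<exists>V. openin (subtopology X (topspace X - C)) V \<and>
            subtopology X (topspace X - C) closure_of V = topspace X - C \<and>
            (\<forall>x\<in>topspace X. 0 < \<rho> x C \<longleftrightarrow> x \<in> V)))"

definition kappa_K2 :: "'a topology \<Rightarrow> ('a \<Rightarrow> 'a set \<Rightarrow> real) \<Rightarrow> bool" where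
  "kappa_K2 X \<rho> \<longleftrightarrow>
     (\<forall>C C'. regularly_closed_in X C \<and> regularly_closed_in X C' \<and> C \<subseteq> C' \<longrightarrow>
       (\<forall>x\<in>topspace X. \<rho> x C' \<le> \<rho> x C))"

definition kappa_K3 :: "'a topology \<Rightarrow> ('a \<Rightarrow> 'a set \<Rightarrow> real) \<Rightarrow> bool" where
  "kappa_K3 X \<rho> \<longleftrightarrow>
     (\<forall>C. regularly_closed_in X C \<longrightarrow> continuous_map X euclideanreal (\<lambda>x. \<rho> x C))"

(* A transfinite family is indexed by a nonempty well-ordered set (I, r); the empty
   family is excluded since it has no real infimum. Indices are drawn from the type
   'a set: every increasing well-ordered family can be re-indexed by its own range,
   so this covers families over any index type (kappa_K4_any_index below). *)
definition kappa_K4 :: "'a topology \<Rightarrow> ('a \<Rightarrow> 'a set \<Rightarrow> real) \<Rightarrow> bool" where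
  "kappa_K4 X \<rho> \<longleftrightarrow>
     (\<forall>(I :: 'a set set) r C.
        well_order_on I r \<and> I \<noteq> {} \<and>
        (\<forall>\<alpha>\<in>I. regularly_closed_in X (C \<alpha>)) \<and>
        (\<forall>\<alpha>\<in>I. \<forall>\<beta>\<in>I. (\<alpha>, \<beta>) \<in> r \<longrightarrow> C \<alpha> \<subseteq> C \<beta>) \<longrightarrow>
        (\<forall>x\<in>topspace X.
           \<rho> x (X closure_of (\<Union>\<alpha>\<in>I. C \<alpha>)) = (INF \<alpha>\<in>I. \<rho> x (C \<alpha>))))"

lemma kappa_K4_any_index:
  fixes I :: "'i set" and C :: "'i \<Rightarrow> 'a set"
  assumes K4: "kappa_K4 X \<rho>"
    and wo: "well_order_on I r" and ne: "I \<noteq> {}"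
    and rc: "\<And>\<alpha>. \<alpha> \<in> I \<Longrightarrow> regularly_closed_in X (C \<alpha>)"
    and mono: "\<And>\<alpha> \<beta>. \<lbrakk>\<alpha> \<in> I; \<beta> \<in> I; (\<alpha>, \<beta>) \<in> r\<rbrakk> \<Longrightarrow> C \<alpha> \<subseteq> C \<beta>"
    and x: "x \<in> topspace X"
  shows "\<rho> x (X closure_of (\<Union>\<alpha>\<in>I. C \<alpha>)) = (INF \<alpha>\<in>I. \<rho> x (C \<alpha>))"
proof -
  define J where "J = C ` I"
  define s where "s = {(A, B). A \<in> J \<and> B \<in> J \<and> A \<subseteq> B}"
  have tot: "(\<alpha>, \<beta>) \<in> r \<or> (\<beta>, \<alpha>) \<in> r" if "\<alpha> \<in> I" "\<beta> \<in> I" for \<alpha> \<beta>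
  proof (cases "\<alpha> = \<beta>")
    case True
    have "refl_on I r"
      using wo by (simp add: well_order_on_def linear_order_on_def partial_order_on_def preorder_on_def)
    then show ?thesis using True that by (simp add: refl_on_def)
  next
    case False
    have "total_on I r"
      using wo by (simp add: well_order_on_def linear_order_on_def)
    then show ?thesis using False that by (simp add: total_on_def)
  qed
  have wfr: "wf (r - Id)"
    using wo by (simp add: well_order_on_def)
  have cmp: "A \<subseteq> B \<or> B \<subseteq> A" if "A \<in> J" "B \<in> J" for A B
    using that tot mono unfolding J_def by blast
  have "wf (s - Id)"
  proof (rule wfI_min)
    fix A :: "'a set" and Q assume "A \<in> Q"
    show "\<exists>z\<in>Q. \<forall>y. (y, z) \<in> s - Id \<longrightarrow> y \<notin> Q"
    proof (cases "Q \<inter> J = {}")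
      case True
      then show ?thesis using \<open>A \<in> Q\<close> unfolding s_def by blast
    next
      case False
      then obtain \<alpha> where "\<alpha> \<in> {i \<in> I. C i \<in> Q}" unfolding J_def by blast
      then obtain m where m: "m \<in> {i \<in> I. C i \<in> Q}"
        and min: "\<And>y. (y, m) \<in> r - Id \<Longrightarrow> y \<notin> {i \<in> I. C i \<in> Q}"
        by (rule wfE_min[OF wfr]) blast
      have "B \<notin> Q" if B: "(B, C m) \<in> s - Id" for B
      proof
        assume "B \<in> Q"
        obtain \<beta> where \<beta>: "\<beta> \<in> I" "B = C \<beta>" using B unfolding s_def J_def by blast
        have "(\<beta>, m) \<notin> r - Id" using min \<beta> \<open>B \<in> Q\<close> by blast
        moreover have "\<beta> \<noteq> m" using B \<beta> by blast
        ultimately have "(m, \<beta>) \<in> r" using tot[of \<beta> m] \<beta> m by blast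
        then have "C m \<subseteq> B" using mono \<beta> m by blast
        then show False using B unfolding s_def by blast
      qed
      then show ?thesis using m by blast
    qed
  qed
  moreover have "refl_on J s" "s \<subseteq> J \<times> J" "trans s" "antisym s"
    unfolding s_def refl_on_def trans_def antisym_def by blast+
  moreover have "total_on J s"
    using cmp unfolding s_def total_on_def by blast
  ultimately have "well_order_on J s"
    unfolding well_order_on_def linear_order_on_def partial_order_on_def preorder_on_def
    by (intro conjI)
  moreover have "J \<noteq> {}" using ne by (simp add: J_def)
  moreover have "\<forall>A\<in>J. regularly_closed_in X A" using rc by (auto simp: J_def)
  moreover have "\<forall>A\<in>J. \<forall>B\<in>J. (A, B) \<in> s \<longrightarrow> A \<subseteq> B" by (auto simp: s_def)
  ultimately have "\<rho> x (X closure_of (\<Union>A\<in>J. A)) = (INF A\<in>J. \<rho> x A)"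
    using K4[unfolded kappa_K4_def, rule_format, of J s "\<lambda>A. A"] x by blast
  then show ?thesis by (simp add: J_def image_image)
qed

definition kappa_metric :: "'a topology \<Rightarrow> ('a \<Rightarrow> 'a set \<Rightarrow> real) \<Rightarrow> bool" where
  "kappa_metric X \<rho> \<longleftrightarrow>
     kappa_nonneg X \<rho> \<and> kappa_K1 X \<rho> \<and> kappa_K2 X \<rho> \<and> kappa_K3 X \<rho> \<and> kappa_K4 X \<rho>"

definition quasi_kappa_metric :: "'a topology \<Rightarrow> ('a \<Rightarrow> 'a set \<Rightarrow> real) \<Rightarrow> bool" where
  "quasi_kappa_metric X \<rho> \<longleftrightarrow>
     kappa_nonneg X \<rho> \<and> kappa_K1_star X \<rho> \<and> kappa_K2 X \<rho> \<and> kappa_K3 X \<rho> \<and> kappa_K4 X \<rho>"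

definition kappa_metrizable :: "'a topology \<Rightarrow> bool" where
  "kappa_metrizable X \<longleftrightarrow> tychonoff_space X \<and> (\<exists>\<rho>. kappa_metric X \<rho>)"

definition quasi_kappa_metrizable :: "'a topology \<Rightarrow> bool" where
  "quasi_kappa_metrizable X \<longleftrightarrow> tychonoff_space X \<and> (\<exists>\<rho>. quasi_kappa_metric X \<rho>)"

end

theory Submission
  imports Defs
begin

text \<open>
  The counterexample is the sequential fan: countably many convergent sequences glued together at
  their common limit \<open>z\<close>. Its isolated points are countable and dense, so weighting the \<open>n\<close>-th of
  them by \<open>1 / (n + 1)\<close> gives a quasi \<open>\<kappa>\<close>-metric that vanishes at \<open>z\<close>. If \<open>\<rho>\<close> were a
  \<open>\<kappa>\<close>-metric, then K4 along the initial segments of the \<open>m\<close>-th sequence, whose union has \<open>z\<close> in its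
  closure, would give an initial segment \<open>S\<^sub>m\<close> with \<open>\<rho>(z, S\<^sub>m) < 1 / (m + 1)\<close>. The union \<open>A\<close>
  of all \<open>S\<^sub>m\<close> is clopen and misses \<open>z\<close>, yet \<open>\<rho>(z, A) = 0\<close> by K2, contradicting K1.
\<close>

section \<open>Inclusion of the two classes\<close>

lemma kappa_metrizable_imp_quasi_kappa_metrizable:
  assumes "kappa_metrizable X"
  shows "quasi_kappa_metrizable X"
proof -
  obtain \<rho> where ty: "tychonoff_space X" and \<rho>: "kappa_metric X \<rho>"
    using assms by (auto simp: kappa_metrizable_def)
  have "kappa_K1_star X \<rho>"
    unfolding kappa_K1_star_def
  proof (intro allI impI)
    fix C assume C: "regularly_closed_in X C"
    \<comment> \<open>The whole complement serves as the dense open set: by K1 and non-negativity,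
      \<open>\<rho> x C\<close> is positive exactly off \<open>C\<close>.\<close>
    let ?V = "topspace X - C"
    have "openin (subtopology X ?V) ?V" "subtopology X ?V closure_of ?V = ?V"
      using openin_topspace[of "subtopology X ?V"] closure_of_topspace[of "subtopology X ?V"]
      by (simp_all add: Int_absorb1)
    moreover have "0 < \<rho> x C \<longleftrightarrow> x \<in> ?V" if "x \<in> topspace X" for x
    proof -
      have "0 \<le> \<rho> x C" "\<rho> x C = 0 \<longleftrightarrow> x \<in> C"
        using \<rho> C that unfolding kappa_metric_def kappa_nonneg_def kappa_K1_def by blast+
      then show ?thesis using that by auto
    qed
    ultimately show "\<exists>V. openin (subtopology X ?V) V \<and> subtopology X ?V closure_of V = ?V \<and>
        (\<forall>x\<in>topspace X. 0 < \<rho> x C \<longleftrightarrow> x \<in> V)"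
      by blast
  qed
  then show ?thesis
    using ty \<rho> unfolding quasi_kappa_metrizable_def quasi_kappa_metric_def kappa_metric_def by blast
qed

section \<open>Topology of the sequential fan\<close>

locale sequential_fan =
  fixes g :: "nat \<times> nat \<Rightarrow> 'a" and z :: 'a
  assumes inj_g: "inj g" and z_notin: "z \<notin> range g"
begin

text \<open>\<open>g (m, n)\<close> is the \<open>n\<close>-th point of the \<open>m\<close>-th
  sequence. The finite exceptional sets may grow arbitrarily with \<open>m\<close>; this lack of
  uniformity is what rules out a \<kappa>-metric.\<close>

definition fan :: "'a topology" where
  "fan = topology (\<lambda>U. U \<subseteq> insert z (range g) \<and> (z \<in> U \<longrightarrow> (\<forall>m. finite {n. g (m, n) \<notin> U})))"

lemma openin_fan:
  "openin fan U \<longleftrightarrow> U \<subseteq> insert z (range g) \<and> (z \<in> U \<longrightarrow> (\<forall>m. finite {n. g (m, n) \<notin> U}))"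
proof -
  have "istopology (\<lambda>U. U \<subseteq> insert z (range g) \<and> (z \<in> U \<longrightarrow> (\<forall>m. finite {n. g (m, n) \<notin> U})))"
    unfolding istopology_def
  proof (rule conjI; intro allI impI conjI; (elim conjE)?)
    fix S T m
    assume "z \<in> S \<longrightarrow> (\<forall>m. finite {n. g (m, n) \<notin> S})" "z \<in> T \<longrightarrow> (\<forall>m. finite {n. g (m, n) \<notin> T})"
      and "z \<in> S \<inter> T"
    then have "finite ({n. g (m, n) \<notin> S} \<union> {n. g (m, n) \<notin> T})" by auto
    then show "finite {n. g (m, n) \<notin> S \<inter> T}"
      by (rule rev_finite_subset) auto
  next
    fix \<K> m
    assume \<K>: "\<forall>K\<in>\<K>. K \<subseteq> insert z (range g) \<and> (z \<in> K \<longrightarrow> (\<forall>m. finite {n. g (m, n) \<notin> K}))"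
      and "z \<in> \<Union>\<K>"
    then obtain K where "K \<in> \<K>" "finite {n. g (m, n) \<notin> K}" by blast
    then show "finite {n. g (m, n) \<notin> \<Union>\<K>}"
      by (auto elim: rev_finite_subset)
  qed auto
  then show ?thesis by (simp add: fan_def topology_inverse')
qed

lemma topspace_fan: "topspace fan = insert z (range g)"
proof -
  have "openin fan (insert z (range g))" by (simp add: openin_fan)
  then show ?thesis
    using openin_subset[of fan] openin_topspace[of fan] unfolding openin_fan by blast
qed

lemma openin_fan_isolated: "U \<subseteq> range g \<Longrightarrow> openin fan U"
  using z_notin by (auto simp: openin_fan)

lemma closedin_fan:
  "closedin fan S \<longleftrightarrow> S \<subseteq> insert z (range g) \<and> (z \<notin> S \<longrightarrow> (\<forall>m. finite {n. g (m, n) \<in> S}))"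
  by (auto simp: closedin_def topspace_fan openin_fan)

text \<open>A closed set missing \<open>z\<close> meets each sequence in a finite set, which the
  closure of \<open>U\<close> does not.\<close>

lemma infinite_sequence_imp_in_closure:
  assumes "U \<subseteq> range g" and inf: "infinite {n. g (m, n) \<in> U}"
  shows "z \<in> fan closure_of U"
proof (rule ccontr)
  assume "z \<notin> fan closure_of U"
  then have "finite {n. g (m, n) \<in> fan closure_of U}"
    using closedin_closure_of[of fan U] unfolding closedin_fan by blast
  moreover have "U \<subseteq> fan closure_of U"
    using assms by (auto intro!: closure_of_subset simp: topspace_fan)
  ultimately show False using inf by (meson finite_subset Collect_mono subset_iff)
qed

text \<open>Only continuity at \<open>z\<close> is at stake, the other points being isolated. There
  it amounts to convergence to \<open>f z\<close> along each sequence separately.\<close>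

lemma continuous_map_fan:
  fixes f :: "'a \<Rightarrow> real"
  assumes fin: "\<And>e m. 0 < e \<Longrightarrow> finite {n. e \<le> \<bar>f (g (m, n)) - f z\<bar>}"
  shows "continuous_map fan euclideanreal f"
  unfolding continuous_map_def
proof (intro conjI allI impI)
  fix U :: "real set" assume "openin euclideanreal U"
  then have "open U" by simp
  have "finite {n. f (g (m, n)) \<notin> U}" if z: "f z \<in> U" for m
  proof -
    obtain e where e: "0 < e" "\<And>y. dist y (f z) < e \<Longrightarrow> y \<in> U"
      using \<open>open U\<close> z by (auto simp: open_dist)
    then have "{n. f (g (m, n)) \<notin> U} \<subseteq> {n. e \<le> \<bar>f (g (m, n)) - f z\<bar>}"
      by (auto simp: dist_real_def) (meson not_le)
    then show ?thesis using fin[OF e(1)] by (rule finite_subset)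
  qed
  then show "openin fan {x \<in> topspace fan. f x \<in> U}"
    by (auto simp: openin_fan topspace_fan)
qed simp

lemma tychonoff_space_fan: "tychonoff_space fan"
proof -
  have "completely_regular_space fan"
    unfolding completely_regular_space_def
  proof (intro allI impI, elim conjE)
    fix S x assume S: "closedin fan S" and x: "x \<in> topspace fan - S"
    \<comment> \<open>For \<open>x = z\<close> the indicator of \<open>S\<close> is eventually 0
      along each sequence, as \<open>S\<close> is closed and misses \<open>z\<close>. Otherwise
      \<open>x\<close> is isolated, and the indicator of its complement differs from 1 at that point
      only.\<close>
    define f :: "'a \<Rightarrow> real" where
      "f = (if x = z then indicator S else indicator (- {x}))"
    have "continuous_map fan euclideanreal f"
    proof (rule continuous_map_fan)
      fix e :: real and m assume "0 < e"
      show "finite {n. e \<le> \<bar>f (g (m, n)) - f z\<bar>}"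
      proof (cases "x = z")
        case True
        then have "finite {n. g (m, n) \<in> S}" "z \<notin> S"
          using S x by (auto simp: closedin_fan)
        then show ?thesis
          using True \<open>0 < e\<close> by (auto simp: f_def indicator_def elim!: rev_finite_subset)
      next
        case False
        have "finite ((\<lambda>n. g (m, n)) -` {x})"
          using inj_g by (intro finite_vimageI) (auto simp: inj_def)
        then show ?thesis
          using False \<open>0 < e\<close> by (auto simp: f_def indicator_def elim!: rev_finite_subset)
      qed
    qed
    then have "continuous_map fan (top_of_set {0..1}) f"
      by (auto simp: continuous_map_in_subtopology f_def indicator_def)
    moreover have "f x = 0" "f ` S \<subseteq> {1}"
      using x by (auto simp: f_def indicator_def)
    ultimately show "\<exists>f. continuous_map fan (top_of_set {0..1}) f \<and> f x = (0::real) \<and> f ` S \<subseteq> {1}"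
      by blast
  qed
  \<comment> \<open>Hausdorffness will follow from regularity and T1. By injectivity of
    \<open>g\<close>, a singleton meets each sequence at most once, hence is closed.\<close>
  moreover have "t1_space fan"
    unfolding t1_space_closedin_singleton
  proof
    fix x assume "x \<in> topspace fan"
    moreover have "finite ((\<lambda>n. g (m, n)) -` {x})" for m
      using inj_g by (intro finite_vimageI) (auto simp: inj_def)
    ultimately show "closedin fan {x}"
      by (auto simp: closedin_fan topspace_fan vimage_def)
  qed
  ultimately show ?thesis
    unfolding tychonoff_space_def
    by (simp add: completely_regular_imp_regular_space regular_t1_imp_Hausdorff_space)
qed

section \<open>A quasi \<kappa>-metric on the fan\<close>

definition fan_dist :: "'a \<Rightarrow> 'a set \<Rightarrow> real" where
  "fan_dist x C = (if x = z \<or> x \<in> C then 0 else 1 / (1 + real (prod_encode (inv g x))))"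

lemma fan_dist_nonneg: "0 \<le> fan_dist x C"
  by (simp add: fan_dist_def)

lemma fan_dist_pos_iff: "0 < fan_dist x C \<longleftrightarrow> x \<noteq> z \<and> x \<notin> C"
  by (auto simp: fan_dist_def add_pos_nonneg)

lemma kappa_K1_star_fan_dist: "kappa_K1_star fan fan_dist"
  unfolding kappa_K1_star_def
proof (intro allI impI)
  fix C assume "regularly_closed_in fan C"
  then have C: "closedin fan C" by (auto simp: regularly_closed_in_def)
  let ?W = "topspace fan - C" and ?V = "range g - C"
  \<comment> \<open>\<open>?V\<close> is the complement of \<open>C\<close> with \<open>z\<close>
    removed, because \<open>fan_dist\<close> vanishes at \<open>z\<close>. Density is in doubt only
    at \<open>z\<close>, and only if \<open>z\<close> lies outside \<open>C\<close>.\<close>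
  have VW: "?V \<subseteq> ?W" by (auto simp: topspace_fan)
  have "?W \<subseteq> fan closure_of ?V"
  proof
    fix x assume x: "x \<in> ?W"
    show "x \<in> fan closure_of ?V"
    proof (cases "x = z")
      case True
      \<comment> \<open>Any one sequence would do; cofinitely many of its points avoid the closed
        set \<open>C\<close>.\<close>
      then have "finite {n. g (0, n) \<in> C}"
        using C x by (auto simp: closedin_fan)
      then have "infinite (- {n. g (0, n) \<in> C})" by (simp add: finite_compl)
      then have "infinite {n. g (0, n) \<in> ?V}" by (simp add: Compl_eq)
      then show ?thesis
        using True infinite_sequence_imp_in_closure[of ?V 0] by blast
    next
      case False
      then have "x \<in> ?V" using x by (auto simp: topspace_fan)
      moreover have "?V \<subseteq> fan closure_of ?V"
        by (rule closure_of_subset) (auto simp: topspace_fan)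
      ultimately show ?thesis by blast
    qed
  qed
  then have "subtopology fan ?W closure_of ?V = ?W"
    using VW by (simp add: closure_of_subtopology Int_absorb1 Int_absorb2)
  moreover have "openin (subtopology fan ?W) ?V"
    using VW by (auto simp: openin_subtopology intro!: exI[of _ ?V] openin_fan_isolated)
  moreover have "\<forall>x\<in>topspace fan. 0 < fan_dist x C \<longleftrightarrow> x \<in> ?V"
    using z_notin by (auto simp: fan_dist_pos_iff topspace_fan)
  ultimately show "\<exists>V. openin (subtopology fan ?W) V \<and> subtopology fan ?W closure_of V = ?W \<and>
      (\<forall>x\<in>topspace fan. 0 < fan_dist x C \<longleftrightarrow> x \<in> V)"
    by blast
qed

lemma kappa_K3_fan_dist: "kappa_K3 fan fan_dist"
  unfolding kappa_K3_def
proof (intro allI impI continuous_map_fan)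
  fix C and e :: real and m
  assume "0 < e"
  \<comment> \<open>Points of \<open>C\<close> contribute 0 < \<open>e\<close>. Elsewhere the weight
    is at most \<open>1 / (1 + n)\<close>, since \<open>prod_encode (m, n)\<close> is at least
    \<open>n\<close>.\<close>
  have "{n. e \<le> \<bar>fan_dist (g (m, n)) C - fan_dist z C\<bar>} \<subseteq> {..nat \<lceil>1 / e\<rceil>}"
  proof
    fix n assume "n \<in> {n. e \<le> \<bar>fan_dist (g (m, n)) C - fan_dist z C\<bar>}"
    then have "e \<le> 1 / (1 + real (prod_encode (m, n)))"
      using \<open>0 < e\<close> inj_g by (auto simp: fan_dist_def split: if_splits)
    then have "1 + real (prod_encode (m, n)) \<le> 1 / e"
      using \<open>0 < e\<close> by (simp add: field_simps)
    then have "real n \<le> 1 / e"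
      using le_prod_encode_2[of n m] by linarith
    then show "n \<in> {..nat \<lceil>1 / e\<rceil>}" by simp linarith
  qed
  then show "finite {n. e \<le> \<bar>fan_dist (g (m, n)) C - fan_dist z C\<bar>}"
    by (rule finite_subset) simp
qed

text \<open>For fixed \<open>x\<close> the value depends on \<open>C\<close> only through membership
  of \<open>x\<close>, and an isolated point lies in the closure of a union iff it lies in some
  member.\<close>

lemma kappa_K4_fan_dist: "kappa_K4 fan fan_dist"
  unfolding kappa_K4_def
proof (intro allI impI ballI, elim conjE)
  fix I :: "'a set set" and r C x
  assume "I \<noteq> {}" and rc: "\<forall>\<alpha>\<in>I. regularly_closed_in fan (C \<alpha>)" and x: "x \<in> topspace fan"
  have sub: "(\<Union>\<alpha>\<in>I. C \<alpha>) \<subseteq> topspace fan"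
    using rc by (auto simp: regularly_closed_in_def dest: in_closure_of[THEN iffD1])
  have in_closure: "x \<in> fan closure_of (\<Union>\<alpha>\<in>I. C \<alpha>) \<longleftrightarrow> (\<exists>\<alpha>\<in>I. x \<in> C \<alpha>)" if "x \<noteq> z"
  proof
    assume "x \<in> fan closure_of (\<Union>\<alpha>\<in>I. C \<alpha>)"
    moreover have "openin fan {x}"
      using x that by (intro openin_fan_isolated) (auto simp: topspace_fan)
    ultimately show "\<exists>\<alpha>\<in>I. x \<in> C \<alpha>" by (fastforce simp: in_closure_of)
  next
    assume "\<exists>\<alpha>\<in>I. x \<in> C \<alpha>"
    then show "x \<in> fan closure_of (\<Union>\<alpha>\<in>I. C \<alpha>)" using closure_of_subset[OF sub] by blast
  qed
  show "fan_dist x (fan closure_of (\<Union>\<alpha>\<in>I. C \<alpha>)) = (INF \<alpha>\<in>I. fan_dist x (C \<alpha>))"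
  proof (cases "x \<noteq> z \<and> (\<exists>\<alpha>\<in>I. x \<in> C \<alpha>)")
    case True
    then obtain \<alpha> where \<alpha>: "\<alpha> \<in> I" "x \<in> C \<alpha>" by blast
    have "(INF \<alpha>\<in>I. fan_dist x (C \<alpha>)) = 0"
    proof (rule cInf_eq_minimum)
      show "0 \<in> (\<lambda>\<alpha>. fan_dist x (C \<alpha>)) ` I"
        using \<alpha> by (auto simp: fan_dist_def intro!: image_eqI[of _ _ \<alpha>])
    qed (auto simp: fan_dist_nonneg)
    then show ?thesis
      using True in_closure by (simp add: fan_dist_def)
  next
    \<comment> \<open>Every term of the infimum is the same number: 0 if \<open>x = z\<close>, and
      the weight of \<open>x\<close> if no member contains \<open>x\<close>.\<close>
    case False
    then have "fan_dist x (C \<alpha>) = fan_dist x (fan closure_of (\<Union>\<alpha>\<in>I. C \<alpha>))" if "\<alpha> \<in> I" for \<alpha>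
      using that in_closure by (auto simp: fan_dist_def)
    then show ?thesis using \<open>I \<noteq> {}\<close> by simp
  qed
qed

lemma quasi_kappa_metrizable_fan: "quasi_kappa_metrizable fan"
proof -
  have "kappa_K2 fan fan_dist"
    by (auto simp: kappa_K2_def fan_dist_def)
  then have "quasi_kappa_metric fan fan_dist"
    by (simp add: quasi_kappa_metric_def kappa_nonneg_def fan_dist_nonneg
        kappa_K1_star_fan_dist kappa_K3_fan_dist kappa_K4_fan_dist)
  then show ?thesis
    using tychonoff_space_fan by (auto simp: quasi_kappa_metrizable_def)
qed

section \<open>Absence of a \<kappa>-metric on the fan\<close>

lemma regularly_closed_in_fan_finite_sequences:
  assumes "A \<subseteq> range g" and "\<And>m. finite {n. g (m, n) \<in> A}"
  shows "regularly_closed_in fan A"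
proof -
  \<comment> \<open>\<open>A\<close> is also open, consisting of isolated points, so it is the
    closure of itself.\<close>
  have "closedin fan A" using assms by (auto simp: closedin_fan)
  then show ?thesis
    using openin_fan_isolated[OF assms(1)] closure_of_closedin[of fan A]
    by (auto simp: regularly_closed_in_def)
qed

lemma not_kappa_metrizable_fan: "\<not> kappa_metrizable fan"
proof
  assume "kappa_metrizable fan"
  then obtain \<rho> where nonneg: "kappa_nonneg fan \<rho>" and K1: "kappa_K1 fan \<rho>"
    and K2: "kappa_K2 fan \<rho>" and K4: "kappa_K4 fan \<rho>"
    by (auto simp: kappa_metrizable_def kappa_metric_def)
  have z: "z \<in> topspace fan" by (simp add: topspace_fan)
  define S where "S m k = (\<lambda>n. g (m, n)) ` {..k}" for m k :: nat
  have in_S: "g (i, n) \<in> S m k \<longleftrightarrow> i = m \<and> n \<le> k" for i n m k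
    using inj_g by (auto simp: S_def dest: injD)
  have S_range: "S m k \<subseteq> range g" for m k by (auto simp: S_def)
  have rc_S: "regularly_closed_in fan (S m k)" for m k
    by (intro regularly_closed_in_fan_finite_sequences S_range)
      (auto simp: in_S intro: rev_finite_subset[OF finite_atMost[of k]])
  have "\<exists>k. \<rho> z (S m k) < 1 / (1 + real m)" for m
  proof -
    let ?L = "\<Union>k. S m k"
    have L: "?L \<subseteq> range g" using S_range by blast
    have "{n. g (m, n) \<in> ?L} = UNIV" by (auto simp: in_S)
    then have "z \<in> fan closure_of ?L"
      using infinite_sequence_imp_in_closure[OF L, of m] by simp
    moreover have "regularly_closed_in fan (fan closure_of ?L)"
      using openin_fan_isolated[OF L] by (auto simp: regularly_closed_in_def)
    ultimately have "\<rho> z (fan closure_of ?L) = 0"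
      using K1 z by (auto simp: kappa_K1_def)
    \<comment> \<open>The initial segments of the \<open>m\<close>-th sequence increase with
      \<open>k\<close>, so K4 applies with the natural numbers in their usual order as index
      set.\<close>
    moreover have "\<rho> z (fan closure_of ?L) = (INF k. \<rho> z (S m k))"
    proof (rule kappa_K4_any_index[OF K4, where r = natLeq])
      show "well_order_on UNIV natLeq"
        using natLeq_Well_order by (simp add: Field_natLeq)
    qed (use rc_S in \<open>auto simp: S_def z natLeq_def\<close>)
    ultimately have "(INF k. \<rho> z (S m k)) < 1 / (1 + real m)" by simp
    moreover have "bdd_below (range (\<lambda>k. \<rho> z (S m k)))"
      using nonneg rc_S z by (intro bdd_belowI[of _ 0]) (auto simp: kappa_nonneg_def)
    ultimately show ?thesis by (auto simp: cInf_less_iff)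
  qed
  then obtain k where k: "\<And>m. \<rho> z (S m (k m)) < 1 / (1 + real m)" by metis
  define A where "A = (\<Union>m. S m (k m))"
  have A_range: "A \<subseteq> range g" using S_range by (auto simp: A_def)
  \<comment> \<open>Distinct sequences are disjoint, so \<open>A\<close> keeps only one finite
    initial segment of each, however fast \<open>k\<close> grows.\<close>
  have "{n. g (m, n) \<in> A} = {..k m}" for m by (auto simp: A_def in_S)
  then have rc_A: "regularly_closed_in fan A"
    by (intro regularly_closed_in_fan_finite_sequences A_range) simp
  have "0 < \<rho> z A"
  proof -
    have "z \<notin> A" using A_range z_notin by blast
    then have "0 \<le> \<rho> z A" "\<rho> z A \<noteq> 0"
      using nonneg K1 rc_A z by (auto simp: kappa_nonneg_def kappa_K1_def)
    then show ?thesis by simp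
  qed
  then obtain m where "1 / (1 + real m) < \<rho> z A"
    using reals_Archimedean[of "\<rho> z A"] by (auto simp: inverse_eq_divide)
  moreover have "\<rho> z A \<le> \<rho> z (S m (k m))"
    using K2 rc_A rc_S z by (auto simp: kappa_K2_def A_def)
  ultimately show False using k[of m] by simp
qed

end

theorem mainTheorem4:
  shows "(\<forall>X :: 'a topology. kappa_metrizable X \<longrightarrow> quasi_kappa_metrizable X) \<and>
         (\<exists>X :: nat set set topology. quasi_kappa_metrizable X \<and> \<not> kappa_metrizable X)"
proof -
  \<comment> \<open>Each pair is coded as a singleton of a singleton, which is nonempty and so
    leaves the empty family free to be the limit point.\<close>
  interpret sequential_fan "\<lambda>p. {{prod_encode p}}" "{} :: nat set set"
    by standard (auto intro: injI)
  show ?thesis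
    using kappa_metrizable_imp_quasi_kappa_metrizable
      quasi_kappa_metrizable_fan not_kappa_metrizable_fan by blast
qed

end
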